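(* The Banach space $L_1([0,1])$ has no Besselian Schauder frame.
   Context: $L_1([0,1])$ is the Banach space of equivalence classes of Lebesgue integrable functions $[0,1]\to\mathbb{K}$, $\mathbb{K}=\mathbb{R}$ or $\mathbb{C}$. A Besselian Schauder frame for a Banach space $E$ is a sequence $((a_n,b_n^* ))_{n\ge1}$ in $E\times E^*$ such that (i) for every $x\in E$ the series $\sum_n b_n^*(x)a_n$ converges in norm to $x$, and (ii) there is $B>0$ with $\sum_{n=1}^\infty|b_n^*(x)||y^*(a_n)|\le B\|x\|_E\|y^*\|_{E^*}$ for all $x\in E$, $y^*\in E^*$. *)

theory Defs
  imports "HOL-Analysis.Analysis"
begin

section \<open>Besselian Schauder frames\<close>

text \<open>
  The scalar field \<open>'k\<close> acts on the space \<open>'e\<close> through an explicit operation \<open>scl\<close>, so that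
  one definition serves real and complex Banach spaces (the library has no class of complex
  Banach spaces). The next locale says that \<open>'e\<close> with its norm is a Banach space over \<open>'k\<close>
  for \<open>scl\<close>.
\<close>

locale banach_space_over = vector_space scl
  for scl :: "'k::real_normed_field \<Rightarrow> 'e::banach \<Rightarrow> 'e" +
  assumes norm_scale: "norm (scl c x) = norm c * norm x"
    and scale_of_real: "scl (of_real r) x = scaleR r x"

text \<open>
  Boundedness of a functional does not depend on whether the space is regarded over \<open>'k\<close> or
  over the reals, and \<^const>\<open>onorm\<close> is the dual norm in either case; \<open>'k\<close>-linearity is the
  additional requirement.
\<close>

definition continuous_dual ::
  "('k::real_normed_field \<Rightarrow> 'e \<Rightarrow> 'e) \<Rightarrow> ('e::banach \<Rightarrow> 'k) set" where
  "continuous_dual scl = {f. Vector_Spaces.linear scl (*) f \<and> bounded_linear f}"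

definition besselian_schauder_frame ::
  "('k::real_normed_field \<Rightarrow> 'e \<Rightarrow> 'e) \<Rightarrow> (nat \<Rightarrow> 'e::banach) \<Rightarrow> (nat \<Rightarrow> 'e \<Rightarrow> 'k) \<Rightarrow> bool" where
  "besselian_schauder_frame scl a b \<longleftrightarrow>
     (\<forall>n. b n \<in> continuous_dual scl) \<and>
     (\<forall>x. (\<lambda>n. scl (b n x) (a n)) sums x) \<and>
     (\<exists>B>0. \<forall>x. \<forall>y \<in> continuous_dual scl.
        summable (\<lambda>n. norm (b n x) * norm (y (a n))) \<and>
        (\<Sum>n. norm (b n x) * norm (y (a n))) \<le> B * norm x * onorm y)"


section \<open>The Banach space \<open>L\<^sub>1([0,1])\<close>\<close>

text \<open>
  Representatives are functions on the whole real line, but only their restriction to \<open>[0,1]\<close>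
  matters: measurability, integrability and almost-everywhere equality all refer to Lebesgue
  measure on \<open>[0,1]\<close>.
\<close>

abbreviation leb01 :: "real measure" where
  "leb01 \<equiv> lebesgue_on {0..1}"

definition l1_eq ::
  "(real \<Rightarrow> 'a) \<Rightarrow> (real \<Rightarrow> 'a::{real_normed_field,banach,second_countable_topology}) \<Rightarrow> bool" where
  "l1_eq f g \<longleftrightarrow> integrable leb01 f \<and> integrable leb01 g \<and> (AE t in leb01. f t = g t)"

lemma l1_eq_part_equivp:
  "part_equivp (l1_eq :: (real \<Rightarrow> 'a::{real_normed_field,banach,second_countable_topology}) \<Rightarrow> _)"
    (is "part_equivp ?R")
proof (rule part_equivpI)
  show "\<exists>f. ?R f f"
    by (rule exI[of _ "\<lambda>_. 0"]) (simp add: l1_eq_def)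
  show "symp ?R"
    by (auto simp: l1_eq_def symp_def eq_commute)
  show "transp ?R"
  proof (rule transpI)
    fix f g h :: "real \<Rightarrow> 'a"
    assume fg: "l1_eq f g" and gh: "l1_eq g h"
    have "AE t in leb01. f t = h t"
      using fg[unfolded l1_eq_def, THEN conjunct2, THEN conjunct2]
        gh[unfolded l1_eq_def, THEN conjunct2, THEN conjunct2]
      by eventually_elim simp
    with fg gh show "l1_eq f h" by (simp add: l1_eq_def)
  qed
qed

quotient_type (overloaded) 'a L1 =
  "real \<Rightarrow> 'a::{real_normed_field,banach,second_countable_topology}" / partial: l1_eq
  by (fact l1_eq_part_equivp)

lift_definition l1_scale ::
  "'a::{real_normed_field,banach,second_countable_topology} \<Rightarrow> 'a L1 \<Rightarrow> 'a L1"
  is "\<lambda>c f t. c * f t"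
  by (auto simp: l1_eq_def elim: eventually_mono)

instantiation L1 :: ("{real_normed_field,banach,second_countable_topology}") real_normed_vector
begin

lift_definition zero_L1 :: "'a L1" is "\<lambda>_. 0"
  by (simp add: l1_eq_def)

lift_definition plus_L1 :: "'a L1 \<Rightarrow> 'a L1 \<Rightarrow> 'a L1" is "\<lambda>f g t. f t + g t"
  by (auto simp: l1_eq_def elim: eventually_elim2)

lift_definition minus_L1 :: "'a L1 \<Rightarrow> 'a L1 \<Rightarrow> 'a L1" is "\<lambda>f g t. f t - g t"
  by (auto simp: l1_eq_def elim: eventually_elim2)

lift_definition uminus_L1 :: "'a L1 \<Rightarrow> 'a L1" is "\<lambda>f t. - f t"
  by (auto simp: l1_eq_def elim: eventually_mono)

lift_definition scaleR_L1 :: "real \<Rightarrow> 'a L1 \<Rightarrow> 'a L1" is "\<lambda>r f t. r *\<^sub>R f t"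
  by (auto simp: l1_eq_def elim: eventually_mono)

lift_definition norm_L1 :: "'a L1 \<Rightarrow> real" is "\<lambda>f. \<integral>t. norm (f t) \<partial>leb01"
  by (intro integral_cong_AE borel_measurable_norm borel_measurable_integrable)
    (auto simp: l1_eq_def elim: eventually_mono)

definition "sgn (x :: 'a L1) = inverse (norm x) *\<^sub>R x"

definition "dist (x :: 'a L1) y = norm (x - y)"

definition "(uniformity :: ('a L1 \<times> 'a L1) filter) =
  (INF e\<in>{0<..}. principal {(x, y). dist x y < e})"

definition "open (U :: 'a L1 set) \<longleftrightarrow>
  (\<forall>x\<in>U. eventually (\<lambda>(x', y). x' = x \<longrightarrow> y \<in> U) uniformity)"

instance
proof
  fix x y z :: "'a L1" and r s :: real
  show "x + y + z = x + (y + z)" by transfer (simp add: l1_eq_def add.assoc)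
  show "x + y = y + x" by transfer (simp add: l1_eq_def add.commute)
  show "0 + x = x" by transfer (simp add: l1_eq_def)
  show "- x + x = 0" by transfer (simp add: l1_eq_def)
  show "x - y = x + - y" by transfer (simp add: l1_eq_def)
  show "r *\<^sub>R (x + y) = r *\<^sub>R x + r *\<^sub>R y" by transfer (simp add: l1_eq_def scaleR_right_distrib)
  show "(r + s) *\<^sub>R x = r *\<^sub>R x + s *\<^sub>R x" by transfer (simp add: l1_eq_def scaleR_left_distrib)
  show "r *\<^sub>R s *\<^sub>R x = (r * s) *\<^sub>R x" by transfer (simp add: l1_eq_def)
  show "1 *\<^sub>R x = x" by transfer (simp add: l1_eq_def)
  show "norm x = 0 \<longleftrightarrow> x = 0"
    by transfer (simp add: l1_eq_def integral_nonneg_eq_0_iff_AE)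
  show "norm (x + y) \<le> norm x + norm y"
  proof transfer
    fix f g :: "real \<Rightarrow> 'a"
    assume "l1_eq f f" "l1_eq g g"
    then have i: "integrable leb01 f" "integrable leb01 g" by (auto simp: l1_eq_def)
    then have "(\<integral>t. norm (f t + g t) \<partial>leb01) \<le> (\<integral>t. norm (f t) + norm (g t) \<partial>leb01)"
      by (intro integral_mono) (auto intro: norm_triangle_ineq)
    with i show "(\<integral>t. norm (f t + g t) \<partial>leb01)
        \<le> (\<integral>t. norm (f t) \<partial>leb01) + (\<integral>t. norm (g t) \<partial>leb01)"
      by simp
  qed
  show "norm (r *\<^sub>R x) = \<bar>r\<bar> * norm x" by transfer simp
qed (simp_all add: sgn_L1_def dist_L1_def uniformity_L1_def open_L1_def)

end

lemma L1_ex_rep: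
  obtains f where "integrable leb01 f" "x = abs_L1 f"
proof -
  have "l1_eq (rep_L1 x) (rep_L1 x)" "abs_L1 (rep_L1 x) = x"
    using Quotient3_L1 unfolding Quotient3_def by blast+
  then show ?thesis using that[of "rep_L1 x"] by (auto simp: l1_eq_def)
qed

lemma norm_abs_L1: "integrable leb01 f \<Longrightarrow> norm (abs_L1 f) = (\<integral>t. norm (f t) \<partial>leb01)"
  by (subst norm_L1.abs_eq) (auto simp: l1_eq_def)

lemma diff_abs_L1:
  "integrable leb01 f \<Longrightarrow> integrable leb01 g \<Longrightarrow> abs_L1 f - abs_L1 g = abs_L1 (\<lambda>t. f t - g t)"
  by (subst minus_L1.abs_eq) (auto simp: l1_eq_def)

lemma sum_abs_L1:
  assumes "\<And>i. integrable leb01 (f i)"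
  shows "(\<Sum>i<n. abs_L1 (f i)) = abs_L1 (\<lambda>t. \<Sum>i<(n::nat). f i t)"
proof (induction n)
  case 0
  show ?case by (simp add: zero_L1_def)
next
  case (Suc n)
  then show ?case using assms by (simp, subst plus_L1.abs_eq) (auto simp: l1_eq_def)
qed

lemma L1_summable:
  fixes x :: "nat \<Rightarrow> 'a::{real_normed_field,banach,second_countable_topology} L1"
  assumes sx: "summable (\<lambda>i. norm (x i))"
  shows "summable x"
proof -
  have "\<exists>f. integrable leb01 f \<and> x i = abs_L1 f" for i
    using L1_ex_rep[of "x i"] by metis
  then obtain f where f [measurable]: "\<And>i. integrable leb01 (f i)" and x: "\<And>i. x i = abs_L1 (f i)"
    by metis
  have sf: "summable (\<lambda>i. \<integral>t. norm (f i t) \<partial>leb01)"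
    using sx by (simp add: x norm_abs_L1 f)
  have "(\<integral>\<^sup>+t. (\<Sum>i. ennreal (norm (f i t))) \<partial>leb01) = (\<Sum>i. \<integral>\<^sup>+t. norm (f i t) \<partial>leb01)"
    by (rule nn_integral_suminf) (use f in measurable)
  also have "\<dots> = (\<Sum>i. ennreal (\<integral>t. norm (f i t) \<partial>leb01))"
    by (intro arg_cong[where f=suminf] ext nn_integral_eq_integral) (auto simp: f)
  also have "\<dots> \<noteq> \<infinity>"
    using sf by (simp add: ennreal_suminf_neq_top)
  finally have "AE t in leb01. (\<Sum>i. ennreal (norm (f i t))) \<noteq> \<infinity>"
    by (intro nn_integral_noteq_infinite) (use f in measurable)
  then have ae: "AE t in leb01. summable (\<lambda>i. norm (f i t))"
    by eventually_elim (auto intro: summable_suminf_not_top)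
  define F where "F t = (\<Sum>i. f i t)" for t
  have F: "integrable leb01 F"
    unfolding F_def by (rule integrable_suminf[OF f ae sf])
  have tail: "norm ((\<Sum>i<n. x i) - abs_L1 F) \<le> (\<Sum>i. \<integral>t. norm (f (i + n) t) \<partial>leb01)" for n
  proof -
    have ae': "AE t in leb01. summable (\<lambda>i. norm (f (i + n) t))"
      using ae by eventually_elim (simp add: summable_iff_shift[of "\<lambda>i. norm (f i _)"])
    have sf': "summable (\<lambda>i. \<integral>t. norm (f (i + n) t) \<partial>leb01)"
      using sf by (simp add: summable_iff_shift[of "\<lambda>i. \<integral>t. norm (f i t) \<partial>leb01"])
    have I: "integrable leb01 (\<lambda>t. \<Sum>i. norm (f (i + n) t))"
      and E: "(\<integral>t. (\<Sum>i. norm (f (i + n) t)) \<partial>leb01) = (\<Sum>i. \<integral>t. norm (f (i + n) t) \<partial>leb01)"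
      using ae' sf' by (auto intro!: integrable_suminf integral_suminf simp: f)
    have "norm ((\<Sum>i<n. x i) - abs_L1 F) = (\<integral>t. norm ((\<Sum>i<n. f i t) - F t) \<partial>leb01)"
      by (simp add: x sum_abs_L1 f F diff_abs_L1 norm_abs_L1)
    also have "\<dots> \<le> (\<integral>t. (\<Sum>i. norm (f (i + n) t)) \<partial>leb01)"
    proof (rule integral_mono_AE)
      show "AE t in leb01. norm ((\<Sum>i<n. f i t) - F t) \<le> (\<Sum>i. norm (f (i + n) t))"
        using ae ae'
      proof eventually_elim
        case (elim t)
        have "F t = (\<Sum>i. f (i + n) t) + (\<Sum>i<n. f i t)"
          unfolding F_def by (rule suminf_split_initial_segment) (rule summable_norm_cancel[OF elim(1)])
        with summable_norm[OF elim(2)] show ?case by (simp add: norm_minus_commute)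
      qed
    qed (use I F f in auto)
    finally show ?thesis by (simp add: E)
  qed
  have "x sums abs_L1 F"
    unfolding sums_def
  proof (rule LIM_zero_cancel, rule Lim_null_comparison)
    show "(\<lambda>n. \<Sum>i. \<integral>t. norm (f (i + n) t) \<partial>leb01) \<longlonglongrightarrow> 0"
      by (rule suminf_exist_split2[OF sf])
  qed (use tail in auto)
  then show ?thesis by (rule sums_summable)
qed

instance L1 :: ("{real_normed_field,banach,second_countable_topology}") banach
proof
  fix X :: "nat \<Rightarrow> 'a L1"
  assume X: "Cauchy X"
  have "\<exists>M. \<forall>m\<ge>M. \<forall>n\<ge>M. norm (X m - X n) < (1/2)^k" for k
    using CauchyD[OF X, of "(1/2)^k"] by simp
  then obtain M where M: "\<And>k m n. m \<ge> M k \<Longrightarrow> n \<ge> M k \<Longrightarrow> norm (X m - X n) < (1/2)^k"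
    by metis
  define r where "r k = (\<Sum>i\<le>k. M i) + k" for k
  have r: "strict_mono r"
    by (simp add: strict_mono_Suc_iff r_def)
  have rM: "M k \<le> r k" for k
    unfolding r_def by (simp add: member_le_sum trans_le_add1)
  have "summable (\<lambda>k. X (r (Suc k)) - X (r k))"
  proof (rule L1_summable, rule summable_comparison_test)
    have "norm (X (r (Suc n)) - X (r n)) \<le> (1/2)^n" for n
    proof (rule less_imp_le, rule M)
      have "r n \<le> r (Suc n)" using r by (simp add: strict_mono_less_eq)
      with rM[of n] show "M n \<le> r (Suc n)" by simp
    qed (rule rM)
    then show "\<exists>N. \<forall>n\<ge>N. norm (norm (X (r (Suc n)) - X (r n))) \<le> (1/2)^n"
      by simp
  qed (simp add: summable_geometric)
  then have "convergent (\<lambda>n. \<Sum>k<n. X (r (Suc k)) - X (r k))"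
    by (simp add: summable_iff_convergent)
  then have "convergent (\<lambda>n. X (r n) - X (r 0))"
    by (simp only: sum_lessThan_telescope[of "\<lambda>n. X (r n)"])
  then have "convergent (X \<circ> r)"
    by (simp add: convergent_diff_const_right_iff comp_def)
  then obtain l where "(X \<circ> r) \<longlonglongrightarrow> l" by (auto simp: convergent_def)
  with Cauchy_converges_subseq[OF X r] show "convergent X"
    by (auto simp: convergent_def comp_def)
qed

interpretation L1: banach_space_over l1_scale
proof
  fix x y :: "'a L1" and c d :: 'a and r :: real
  show "l1_scale c (x + y) = l1_scale c x + l1_scale c y"
    by transfer (simp add: l1_eq_def distrib_left)
  show "l1_scale (c + d) x = l1_scale c x + l1_scale d x"
    by transfer (simp add: l1_eq_def distrib_right)
  show "l1_scale c (l1_scale d x) = l1_scale (c * d) x"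
    by transfer (simp add: l1_eq_def mult.assoc)
  show "l1_scale 1 x = x"
    by transfer (simp add: l1_eq_def)
  show "norm (l1_scale c x) = norm c * norm x"
    by transfer (simp add: norm_mult)
  show "l1_scale (of_real r) x = r *\<^sub>R x"
    by transfer (simp add: l1_eq_def scaleR_conv_of_real)
qed

end

theory Submission
  imports Defs
begin

text \<open>
  For finite \<open>A\<close> put \<open>T\<^sub>A x = (\<Sum>n\<in>A. b n x \<cdot> a n)\<close>. The Besselian condition bounds all \<open>\<parallel>T\<^sub>A\<parallel>\<close> by
  one constant \<open>C\<close>. Then also \<open>\<parallel>I - T\<^sub>A\<parallel> \<le> C\<close>, because \<open>I - T\<^sub>A\<close> is a pointwise limit of operators
  \<open>T\<^sub>D\<close> with \<open>D\<close> finite and disjoint from \<open>A\<close>. But finite rank operators on \<open>L\<^sub>1([0,1])\<close> satisfy the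
  Daugavet equation \<open>\<parallel>I - T\<parallel> = 1 + \<parallel>T\<parallel>\<close>, so all \<open>\<parallel>T\<^sub>A\<parallel>\<close> are even bounded by \<open>C - 1\<close>, and iterating
  makes the bound negative.
\<close>

section \<open>Restriction to short intervals\<close>

lemma l1_eq_refl_iff: "l1_eq f f \<longleftrightarrow> integrable leb01 f"
  by (simp add: l1_eq_def)

lemma l1_eqI:
  assumes "integrable leb01 f" "integrable leb01 g" "\<And>t. t \<in> {0..1} \<Longrightarrow> f t = g t"
  shows "l1_eq f g"
  using assms by (auto simp: l1_eq_def)

lemma integrable_restrict_leb01:
  fixes f :: "real \<Rightarrow> 'a::{banach,second_countable_topology}"
  shows "integrable leb01 f \<Longrightarrow> integrable leb01 (\<lambda>t. indicator {c..<d} t *\<^sub>R f t)"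
proof -
  assume "integrable leb01 f"
  \<comment> \<open>The measurable sets of \<open>leb01\<close> are subsets of [0,1], so the
    interval is first cut down to [0,1]; there the two indicators coincide.\<close>
  then have "integrable leb01 (\<lambda>t. indicator ({c..<d} \<inter> {0..1}) t *\<^sub>R f t)"
    by (intro integrable_mult_indicator) (auto simp: sets_restrict_space_iff)
  moreover have "integrable leb01 (\<lambda>t. indicator ({c..<d} \<inter> {0..1}) t *\<^sub>R f t)
      \<longleftrightarrow> integrable leb01 (\<lambda>t. indicator {c..<d} t *\<^sub>R f t)"
    by (rule Bochner_Integration.integrable_cong) (auto simp: indicator_def)
  ultimately show ?thesis by blast
qed

lemma measure_interval_leb01: "c \<le> d \<Longrightarrow> measure leb01 ({c..<d} \<inter> {0..1}) \<le> d - c"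
proof -
  assume "c \<le> d"
  have "measure leb01 ({c..<d} \<inter> {0..1}) = measure lebesgue ({c..<d} \<inter> {0..1})"
    by (simp add: measure_restrict_space)
  also have "\<dots> \<le> measure lebesgue {c..<d}"
    by (intro measure_mono_fmeasurable)
      (use \<open>c \<le> d\<close> in \<open>auto intro!: fmeasurableI\<close>)
  finally show ?thesis using \<open>c \<le> d\<close> by simp
qed

text \<open>Half-open intervals let adjacent pieces tile without overlap, so that joining them is a
  pointwise identity.\<close>

lift_definition l1_restrict ::
  "real \<Rightarrow> real \<Rightarrow> 'a::{real_normed_field,banach,second_countable_topology} L1 \<Rightarrow> 'a L1"
  is "\<lambda>c d f t. indicator {c..<d} t *\<^sub>R f t"
  by (auto simp: l1_eq_def intro: integrable_restrict_leb01 elim: eventually_mono)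

lemma l1_restrict_scale: "l1_restrict c d (l1_scale k x) = l1_scale k (l1_restrict c d x)"
  by transfer (auto simp: l1_eq_def intro: integrable_restrict_leb01)

lemma l1_restrict_add: "l1_restrict c d (x + y) = l1_restrict c d x + l1_restrict c d y"
  by transfer (auto simp: l1_eq_def scaleR_right_distrib intro: integrable_restrict_leb01)

lemma l1_restrict_0: "l1_restrict c d 0 = 0"
  by transfer (auto simp: l1_eq_def)

lemma l1_restrict_sum: "l1_restrict c d (\<Sum>i\<in>A. x i) = (\<Sum>i\<in>A. l1_restrict c d (x i))"
  by (induction A rule: infinite_finite_induct) (simp_all add: l1_restrict_0 l1_restrict_add)

lemma l1_restrict_join:
  assumes "c \<le> d" "d \<le> e"
  shows "l1_restrict c d x + l1_restrict d e x = l1_restrict c e x"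
  using assms
  by transfer
    (rule l1_eqI, simp_all only: l1_eq_refl_iff integrable_restrict_leb01 Bochner_Integration.integrable_add,
      simp add: indicator_def)

text \<open>The two pieces have disjoint supports, and the norm of L1 is additive on such
  functions.\<close>

lemma norm_l1_restrict_join:
  assumes "c \<le> d" "d \<le> e"
  shows "norm (l1_restrict c d x) + norm (l1_restrict d e x) = norm (l1_restrict c e x)"
  using assms
proof transfer
  fix c d e :: real and f :: "real \<Rightarrow> 'a"
  assume f: "l1_eq f f" and le: "c \<le> d" "d \<le> e"
  have "(\<integral>t. norm (indicator {c..<d} t *\<^sub>R f t) \<partial>leb01) + (\<integral>t. norm (indicator {d..<e} t *\<^sub>R f t) \<partial>leb01)
    = (\<integral>t. norm (indicator {c..<d} t *\<^sub>R f t) + norm (indicator {d..<e} t *\<^sub>R f t) \<partial>leb01)"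
    using f by (intro Bochner_Integration.integral_add[symmetric] integrable_norm integrable_restrict_leb01)
      (auto simp: l1_eq_def)
  also have "\<dots> = (\<integral>t. norm (indicator {c..<e} t *\<^sub>R f t) \<partial>leb01)"
    using le by (intro Bochner_Integration.integral_cong) (auto simp: indicator_def)
  finally show "(\<integral>t. norm (indicator {c..<d} t *\<^sub>R f t) \<partial>leb01) + (\<integral>t. norm (indicator {d..<e} t *\<^sub>R f t) \<partial>leb01)
    = (\<integral>t. norm (indicator {c..<e} t *\<^sub>R f t) \<partial>leb01)" .
qed

text \<open>\<open>1 < d\<close> puts the endpoint 1 inside the half-open interval, so the functions
  agree at every point of [0,1] and \<open>l1_eqI\<close> applies.\<close>

lemma l1_restrict_whole:
  assumes "c \<le> 0" "1 < d"
  shows "l1_restrict c d x = x"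
  using assms
  by transfer
    (rule l1_eqI, simp_all only: l1_eq_refl_iff integrable_restrict_leb01, simp add: indicator_def)

lemma l1_restrict_empty: "l1_restrict c c x = 0"
  by transfer (simp add: l1_eq_def)

lemma l1_restrict_partition:
  assumes "0 \<le> h"
  shows "(\<Sum>i<n. l1_restrict (real i * h) (real (Suc i) * h) x) = l1_restrict 0 (real n * h) x"
    and "(\<Sum>i<n. norm (l1_restrict (real i * h) (real (Suc i) * h) x)) = norm (l1_restrict 0 (real n * h) x)"
proof (induction n)
  case 0
  { case 1 show ?case by (simp add: l1_restrict_empty) }
  { case 2 show ?case by (simp add: l1_restrict_empty) }
next
  case (Suc n)
  have "0 \<le> real n * h" "real n * h \<le> real (Suc n) * h"
    using assms by (auto intro: mult_right_mono)
  note join = l1_restrict_join[OF this] norm_l1_restrict_join[OF this]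
  { case 1 show ?case using Suc join(1) by (simp del: of_nat_Suc) }
  { case 2 show ?case using Suc join(2) by (simp del: of_nat_Suc) }
qed

text \<open>Integrates a pointwise estimate: off the interval both sides are the norm of
  \<open>g t\<close>; on it, this is the triangle inequality. If \<open>y\<close> has little mass on
  the interval, the norms of the restricted \<open>x\<close> and of \<open>y\<close> almost add
  up.\<close>

lemma norm_diff_l1_restrict:
  "norm (l1_restrict c d x) + norm y \<le> norm (l1_restrict c d x - y) + 2 * norm (l1_restrict c d y)"
proof transfer
  fix c d :: real and f g :: "real \<Rightarrow> 'a"
  assume "l1_eq f f" "l1_eq g g"
  then have i: "integrable leb01 f" "integrable leb01 g" by (auto simp: l1_eq_def)
  let ?P = "\<lambda>f t. indicator {c..<d} t *\<^sub>R f t :: 'a"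
  note P = i[THEN integrable_restrict_leb01, of c d]
  have "(\<integral>t. norm (?P f t) \<partial>leb01) + (\<integral>t. norm (g t) \<partial>leb01) = (\<integral>t. norm (?P f t) + norm (g t) \<partial>leb01)"
    using i by (intro Bochner_Integration.integral_add[symmetric] integrable_norm integrable_restrict_leb01)
  also have "\<dots> \<le> (\<integral>t. norm (?P f t - g t) + 2 * norm (?P g t) \<partial>leb01)"
  proof (rule integral_mono)
    fix t
    have "norm (f t) \<le> norm (f t - g t) + norm (g t)"
      using norm_triangle_ineq[of "f t - g t" "g t"] by simp
    then show "norm (?P f t) + norm (g t) \<le> norm (?P f t - g t) + 2 * norm (?P g t)"
      by (auto simp: indicator_def)
  qed (intro Bochner_Integration.integrable_add Bochner_Integration.integrable_diff
      integrable_norm integrable_mult_right i P)+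
  also have "\<dots> = (\<integral>t. norm (?P f t - g t) \<partial>leb01) + 2 * (\<integral>t. norm (?P g t) \<partial>leb01)"
    by (simp only: Bochner_Integration.integral_add[OF integrable_norm integrable_mult_right]
      integral_mult_right_zero Bochner_Integration.integrable_diff integrable_norm i P)
  finally show "(\<integral>t. norm (?P f t) \<partial>leb01) + (\<integral>t. norm (g t) \<partial>leb01)
    \<le> (\<integral>t. norm (?P f t - g t) \<partial>leb01) + 2 * (\<integral>t. norm (?P g t) \<partial>leb01)" .
qed

text \<open>Absolute continuity of the integral, uniform in the position \<open>c\<close> of the
  interval.\<close>

lemma eventually_l1_restrict_small:
  fixes x :: "'a::{real_normed_field,banach,second_countable_topology} L1"
  assumes "0 < e"
  shows "\<forall>\<^sub>F n in sequentially. \<forall>c. norm (l1_restrict c (c + 1 / real n) x) \<le> e"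
proof -
  obtain f :: "real \<Rightarrow> 'a" where f: "integrable leb01 f" and x: "x = abs_L1 f"
    by (rule L1_ex_rep)
  then have [measurable]: "f \<in> borel_measurable leb01" by auto
  \<comment> \<open>\<open>w m\<close> is the part of the norm of \<open>f\<close> above the level
    \<open>m\<close>. Its integral tends to 0 by dominated convergence.\<close>
  define w where "w m t = (if real m < norm (f t) then norm (f t) else 0)" for m t
  have [measurable]: "w m \<in> borel_measurable leb01" for m
    unfolding w_def by measurable
  have "(\<lambda>m. w m t) \<longlonglongrightarrow> 0" for t
  proof (rule tendsto_eventually)
    show "\<forall>\<^sub>F m in sequentially. w m t = 0"
      using eventually_ge_at_top[of "nat \<lceil>norm (f t)\<rceil>"]
      by eventually_elim (simp add: w_def nat_le_iff ceiling_le_iff)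
  qed
  then have "(\<lambda>m. \<integral>t. w m t \<partial>leb01) \<longlonglongrightarrow> (\<integral>t. 0 \<partial>leb01)"
    by (intro integral_dominated_convergence[where w="\<lambda>t. norm (f t)"]) (use f in \<open>auto simp: w_def\<close>)
  then have "\<forall>\<^sub>F m in sequentially. (\<integral>t. w m t \<partial>leb01) < e / 2"
    using assms by (intro order_tendstoD) auto
  then obtain m where m: "(\<integral>t. w m t \<partial>leb01) < e / 2"
    by (auto simp: eventually_sequentially)
  have iw: "integrable leb01 (w m)"
    by (rule Bochner_Integration.integrable_bound[OF integrable_norm[OF f]]) (auto simp: w_def)
  have "(\<lambda>n. real m * (1 / real n)) \<longlonglongrightarrow> 0"
    by (intro tendsto_mult_right_zero lim_1_over_n)
  then have "\<forall>\<^sub>F n in sequentially. real m * (1 / real n) < e / 2"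
    using assms by (intro order_tendstoD) auto
  then show ?thesis
  proof eventually_elim
    case (elim n)
    show ?case
    proof
      fix c :: real
      let ?J = "{c..<c + 1 / real n} \<inter> {0..1}"
      have iJ: "integrable leb01 (indicat_real ?J)"
      proof (rule integrable_real_indicator)
        have "emeasure leb01 ?J \<le> emeasure leb01 (space leb01)"
          by (rule emeasure_space)
        also have "\<dots> < \<infinity>" by (simp add: emeasure_restrict_space)
        finally show "emeasure leb01 ?J < \<infinity>" .
      qed (auto simp: sets_restrict_space_iff)
      have "norm (l1_restrict c (c + 1 / real n) x) = (\<integral>t. norm (indicator {c..<c + 1 / real n} t *\<^sub>R f t) \<partial>leb01)"
        unfolding x by (subst l1_restrict.abs_eq) (auto simp: l1_eq_def f norm_abs_L1 integrable_restrict_leb01)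
      \<comment> \<open>What lies below the level contributes at most \<open>m\<close> times the
        length of the interval, whatever \<open>c\<close> is.\<close>
      also have "\<dots> \<le> (\<integral>t. w m t + real m * indicat_real ?J t \<partial>leb01)"
      proof (rule integral_mono)
        show "integrable leb01 (\<lambda>t. w m t + real m * indicat_real ?J t)"
          by (intro Bochner_Integration.integrable_add integrable_mult_right iw iJ)
      qed (auto simp: w_def indicator_def intro!: integrable_norm[OF integrable_restrict_leb01[OF f], simplified])
      also have "\<dots> = (\<integral>t. w m t \<partial>leb01) + real m * measure leb01 ?J"
        using iw iJ by (simp add: Int_commute)
      also have "\<dots> \<le> (\<integral>t. w m t \<partial>leb01) + real m * (1 / real n)"
        using measure_interval_leb01[of c "c + 1 / real n"]
        by (intro add_left_mono mult_left_mono) auto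
      also have "\<dots> \<le> e" using m elim by linarith
      finally show "norm (l1_restrict c (c + 1 / real n) x) \<le> e" .
    qed
  qed
qed

section \<open>Uniform bounds for finite sums of the frame\<close>

text \<open>Instead of Hahn-Banach, an explicit functional serves: integration against the inverse
  sign of a representative of \<open>x\<close>.\<close>

lemma l1_norming_functional:
  fixes x :: "'a::{real_normed_field,banach,second_countable_topology} L1"
  obtains y where "y \<in> continuous_dual l1_scale" "onorm y \<le> 1" "norm (y x) = norm x"
proof -
  obtain f :: "real \<Rightarrow> 'a" where f: "integrable leb01 f" and x: "x = abs_L1 f"
    by (rule L1_ex_rep)
  \<comment> \<open>Chosen so that \<open>f t * s t\<close> is the norm of \<open>f t\<close> as a
    scalar, while \<open>s\<close> is bounded by 1.\<close>
  define s where "s t = (if f t = 0 then 0 else of_real (norm (f t)) / f t)" for t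
  have [measurable]: "f \<in> borel_measurable leb01" using f by auto
  have [measurable]: "s \<in> borel_measurable leb01" unfolding s_def by measurable
  have s: "norm (s t) \<le> 1" for t
    by (simp add: s_def norm_divide)
  have i: "integrable leb01 (\<lambda>t. g t * s t)" if "integrable leb01 g" for g
  proof (rule Bochner_Integration.integrable_bound[OF that])
    show "(\<lambda>t. g t * s t) \<in> borel_measurable leb01" using that by measurable
  qed (use s in \<open>auto simp: norm_mult intro!: mult_left_le\<close>)
  \<comment> \<open>Defined through a chosen representative; \<open>y_abs\<close> shows that every
    representative gives the same value.\<close>
  define y where "y z = (\<integral>t. rep_L1 z t * s t \<partial>leb01)" for z
  have ae: "AE t in leb01. rep_L1 (abs_L1 g) t = g t" if "integrable leb01 g" for g :: "real \<Rightarrow> 'a"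
    using Quotient3_L1 that by (auto simp: Quotient3_def l1_eq_def)
  have ri: "integrable leb01 (rep_L1 z)" for z :: "'a L1"
    using Quotient3_L1 by (auto simp: Quotient3_def l1_eq_def)
  have y_abs: "y (abs_L1 g) = (\<integral>t. g t * s t \<partial>leb01)" if g: "integrable leb01 g" for g
    unfolding y_def
  proof (rule integral_cong_AE)
    show "AE t in leb01. rep_L1 (abs_L1 g) t * s t = g t * s t"
      using ae[OF g] by eventually_elim simp
  qed (use i[OF g] i[OF ri] in auto)
  have y_add: "y (u + v) = y u + y v" for u v
  proof -
    obtain g h where "integrable leb01 g" "u = abs_L1 g" "integrable leb01 h" "v = abs_L1 h"
      using L1_ex_rep by metis
    then show ?thesis
      by (simp add: plus_L1.abs_eq l1_eq_refl_iff y_abs i distrib_right)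
  qed
  have y_scale: "y (l1_scale c u) = c * y u" for c u
  proof -
    obtain g where "integrable leb01 g" "u = abs_L1 g"
      using L1_ex_rep by metis
    then show ?thesis
      by (simp add: l1_scale.abs_eq l1_eq_refl_iff y_abs i mult.assoc)
  qed
  have y_bound: "norm (y u) \<le> norm u" for u
  proof -
    obtain g where g: "integrable leb01 g" "u = abs_L1 g"
      using L1_ex_rep by metis
    have "norm (y u) \<le> (\<integral>t. norm (g t * s t) \<partial>leb01)"
      using g by (simp add: y_abs)
    also have "\<dots> \<le> (\<integral>t. norm (g t) \<partial>leb01)"
      by (rule integral_mono[OF integrable_norm[OF i] integrable_norm]) (use g s in \<open>auto simp: norm_mult intro!: mult_left_le\<close>)
    finally show ?thesis using g by (simp add: norm_abs_L1)
  qed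
  show thesis
  proof
    have "bounded_linear y"
      by (rule bounded_linear_intro[where K=1])
        (use y_scale[of "of_real _"] y_bound in \<open>auto simp: y_add L1.scale_of_real scaleR_conv_of_real\<close>)
    moreover have "Vector_Spaces.linear l1_scale (*) y"
      by (intro Vector_Spaces.linear_iff[THEN iffD2] conjI allI y_add y_scale)
        (unfold_locales, auto simp: algebra_simps)
    ultimately show "y \<in> continuous_dual l1_scale" by (simp add: continuous_dual_def)
    show "onorm y \<le> 1" using y_bound by (intro onorm_bound) auto
    have "y x = (\<integral>t. of_real (norm (f t)) \<partial>leb01)"
      unfolding x y_abs[OF f] by (intro Bochner_Integration.integral_cong) (auto simp: s_def)
    then show "norm (y x) = norm x"
      using f by (simp add: x norm_abs_L1)
  qed
qed

text \<open>The Besselian inequality is tested on a functional that norms the finite sum itself; the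
  full series dominates the finite one.\<close>

lemma besselian_partial_sums_bounded:
  fixes a :: "nat \<Rightarrow> 'a::{real_normed_field,banach,second_countable_topology} L1"
  assumes "besselian_schauder_frame l1_scale a b"
  obtains B where "\<And>A x. finite A \<Longrightarrow> norm (\<Sum>n\<in>A. l1_scale (b n x) (a n)) \<le> B * norm x"
proof -
  obtain B where B: "B > 0" and "\<forall>x. \<forall>y \<in> continuous_dual l1_scale.
        summable (\<lambda>n. norm (b n x) * norm (y (a n))) \<and>
        (\<Sum>n. norm (b n x) * norm (y (a n))) \<le> B * norm x * onorm y"
    using assms unfolding besselian_schauder_frame_def by (elim conjE exE) (rule that)
  then have bound: "summable (\<lambda>n. norm (b n x) * norm (y (a n)))"
    "(\<Sum>n. norm (b n x) * norm (y (a n))) \<le> B * norm x * onorm y"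
    if "y \<in> continuous_dual l1_scale" for x y
    using that by simp_all
  show thesis
  proof
    fix A :: "nat set" and x :: "'a L1"
    assume A: "finite A"
    let ?s = "\<Sum>n\<in>A. l1_scale (b n x) (a n)"
    obtain y where y: "y \<in> continuous_dual l1_scale" "onorm y \<le> 1" "norm (y ?s) = norm ?s"
      by (rule l1_norming_functional)
    interpret y: Vector_Spaces.linear l1_scale "(*)" y
      using y by (simp add: continuous_dual_def)
    have "norm ?s = norm (\<Sum>n\<in>A. b n x * y (a n))"
      by (simp add: y(3)[symmetric] y.sum y.scale)
    also have "\<dots> \<le> (\<Sum>n\<in>A. norm (b n x) * norm (y (a n)))"
      by (rule sum_norm_le) (simp add: norm_mult)
    also have "\<dots> \<le> (\<Sum>n. norm (b n x) * norm (y (a n)))"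
      using A by (intro sum_le_suminf bound(1)[OF y(1)]) auto
    also have "\<dots> \<le> B * norm x * onorm y"
      by (rule bound(2)[OF y(1)])
    also have "\<dots> \<le> B * norm x"
      using y(2) B by (intro mult_left_le) auto
    finally show "norm ?s \<le> B * norm x" .
  qed
qed

section \<open>Daugavet estimate for finite rank operators\<close>

text \<open>
  Cut \<open>x\<close> into pieces \<open>u\<close> over short intervals. Relative to \<open>\<parallel>u\<parallel>\<close>, the part of \<open>T u\<close> lying on the
  interval of \<open>u\<close> is negligible, so \<open>\<parallel>u - T u\<parallel>\<close> is almost \<open>\<parallel>u\<parallel> + \<parallel>T u\<parallel>\<close>; the norm is additive over
  the pieces.
\<close>

lemma l1_daugavet_finite_rank:
  fixes a :: "nat \<Rightarrow> 'a::{real_normed_field,banach,second_countable_topology} L1"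
  assumes A: "finite A"
    and b: "\<And>n. bounded_linear (b n)"
    and le: "\<And>u. norm (u - (\<Sum>n\<in>A. l1_scale (b n u) (a n))) \<le> C * norm u"
  shows "norm x + norm (\<Sum>n\<in>A. l1_scale (b n x) (a n)) \<le> C * norm x"
proof -
  define T where "T u = (\<Sum>n\<in>A. l1_scale (b n u) (a n))" for u
  define K where "K = (\<Sum>n\<in>A. onorm (b n))"
  have K: "K \<ge> 0" unfolding K_def by (intro sum_nonneg onorm_pos_le b)
  have T_sum: "T (\<Sum>i<N. u i) = (\<Sum>i<N. T (u i))" for u and N :: nat
    unfolding T_def
    by (subst sum.swap) (simp add: linear_sum[OF bounded_linear.linear[OF b]] L1.scale_sum_left)
  have main: "norm x + norm (T x) \<le> C * norm x + 2 * (e * K * norm x)" if e: "0 < e" for e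
  proof -
    have "\<forall>\<^sub>F N in sequentially. N > 0 \<and> (\<forall>n\<in>A. \<forall>c. norm (l1_restrict c (c + 1 / real N) (a n)) \<le> e)"
      using A e by (intro eventually_conj eventually_gt_at_top eventually_ball_finite ballI
          eventually_l1_restrict_small)
    \<comment> \<open>As \<open>A\<close> is finite, one mesh width makes all pieces of all
      \<open>a n\<close> with \<open>n\<close> in \<open>A\<close> small.\<close>
    then obtain N :: nat where N: "N > 0"
      and small: "\<And>n c. n \<in> A \<Longrightarrow> norm (l1_restrict c (c + 1 / real N) (a n)) \<le> e"
      by (auto simp: eventually_sequentially)
    let ?h = "1 / real N"
    define P :: "nat \<Rightarrow> 'a L1 \<Rightarrow> 'a L1" where "P i = l1_restrict (real i * ?h) (real (Suc i) * ?h)" for i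
    have step: "real (Suc i) * ?h = real i * ?h + ?h" for i by (simp add: add_divide_distrib)
    \<comment> \<open>\<open>N\<close> pieces would stop just short of the point 1; with
      \<open>Suc N\<close> of them all of [0,1] is covered.\<close>
    have whole: "l1_restrict 0 (real (Suc N) * ?h) x = x"
      using N by (intro l1_restrict_whole) (auto simp: field_simps)
    have x: "(\<Sum>i<Suc N. P i x) = x" and nx: "(\<Sum>i<Suc N. norm (P i x)) = norm x"
      unfolding P_def using l1_restrict_partition[of ?h x "Suc N"] whole by (simp_all del: of_nat_Suc sum.lessThan_Suc)
    have piece: "norm (P i x) + norm (T (P i x)) \<le> C * norm (P i x) + 2 * (e * K * norm (P i x))" for i
    proof -
      let ?u = "P i x"
      have P_small: "norm (P i (a n)) \<le> e" if "n \<in> A" for n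
        using small[OF that, of "real i * ?h"] by (simp only: P_def step)
      \<comment> \<open>The coefficients \<open>b n ?u\<close> scale with the norm of
        \<open>?u\<close>, and the pieces of \<open>a n\<close> are at most \<open>e\<close>, so the
        bound is relative to that norm.\<close>
      have "norm (P i (T ?u)) \<le> (\<Sum>n\<in>A. norm (b n ?u) * norm (P i (a n)))"
        unfolding T_def P_def
        by (simp add: l1_restrict_sum l1_restrict_scale L1.norm_scale sum_norm_le)
      also have "\<dots> \<le> (\<Sum>n\<in>A. onorm (b n) * norm ?u * e)"
        by (intro sum_mono mult_mono onorm[OF b] mult_nonneg_nonneg onorm_pos_le[OF b])
          (simp_all add: P_small)
      also have "\<dots> = e * K * norm ?u"
        by (simp add: K_def sum_distrib_left sum_distrib_right mult_ac)
      finally have "norm (P i (T ?u)) \<le> e * K * norm ?u" .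
      moreover have "norm (?u - T ?u) \<le> C * norm ?u" using le by (simp add: T_def)
      moreover have "norm ?u + norm (T ?u) \<le> norm (?u - T ?u) + 2 * norm (P i (T ?u))"
        unfolding P_def by (rule norm_diff_l1_restrict)
      ultimately show ?thesis by linarith
    qed
    have "norm x + norm (T x) \<le> (\<Sum>i<Suc N. norm (P i x)) + (\<Sum>i<Suc N. norm (T (P i x)))"
      using norm_sum[of "\<lambda>i. T (P i x)" "{..<Suc N}"] by (simp only: nx T_sum[symmetric] x)
    also have "\<dots> \<le> (\<Sum>i<Suc N. C * norm (P i x) + 2 * (e * K * norm (P i x)))"
      unfolding sum.distrib[symmetric] by (rule sum_mono) (rule piece)
    also have "\<dots> = C * norm x + 2 * (e * K * norm x)"
      by (simp only: sum.distrib sum_distrib_left[symmetric] nx)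
    finally show ?thesis .
  qed
  have "norm x + norm (T x) \<le> C * norm x"
  proof (rule tendsto_lowerbound)
    show "((\<lambda>e. C * norm x + 2 * (e * K * norm x)) \<longlongrightarrow> C * norm x) (at_right 0)"
      by (auto intro!: tendsto_eq_intros)
    show "\<forall>\<^sub>F e in at_right 0. norm x + norm (T x) \<le> C * norm x + 2 * (e * K * norm x)"
      using eventually_at_right_less[of 0] by eventually_elim (rule main)
  qed simp
  then show ?thesis by (simp add: T_def)
qed

section \<open>Descent of the uniform bound\<close>

theorem no_besselian_schauder_frame_L1:
  fixes a :: "nat \<Rightarrow> 'a::{real_normed_field,banach,second_countable_topology} L1"
  shows "\<not> besselian_schauder_frame l1_scale a b"
proof
  assume frame: "besselian_schauder_frame l1_scale a b"
  define T where "T A u = (\<Sum>n\<in>A. l1_scale (b n u) (a n))" for A u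
  have b: "bounded_linear (b n)" for n
    using frame by (auto simp: besselian_schauder_frame_def continuous_dual_def)
  have sums: "(\<lambda>n. l1_scale (b n u) (a n)) sums u" for u
    using frame by (simp add: besselian_schauder_frame_def)
  obtain B where B: "\<And>A u. finite A \<Longrightarrow> norm (T A u) \<le> B * norm u"
    using besselian_partial_sums_bounded[OF frame] unfolding T_def by blast
  \<comment> \<open>\<open>C\<close> is arbitrary and the bound ranges over all finite sets, so the
    conclusion can be fed back as the next hypothesis.\<close>
  have improve: "norm (T A x) \<le> (C - 1) * norm x"
    if A: "finite A" and C: "\<And>A u. finite A \<Longrightarrow> norm (T A u) \<le> C * norm u" for A x C
  proof -
    have "norm (u - T A u) \<le> C * norm u" for u
    proof (rule tendsto_upperbound)
      show "(\<lambda>N. norm (T {..<N} u - T A u)) \<longlonglongrightarrow> norm (u - T A u)"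
        using sums[of u] unfolding sums_def T_def by (intro tendsto_intros)
      show "\<forall>\<^sub>F N in sequentially. norm (T {..<N} u - T A u) \<le> C * norm u"
      proof -
        obtain M where M: "A \<subseteq> {..<M}" using A by (meson finite_nat_iff_bounded)
        show ?thesis using eventually_ge_at_top[of M]
        proof eventually_elim
          case (elim N)
          \<comment> \<open>Once \<open>{..<N}\<close> contains \<open>A\<close>, the difference is
            again a finite sum of the frame, over the complement of \<open>A\<close>, so
            \<open>C\<close> bounds it.\<close>
          then have "T {..<N} u - T A u = T ({..<N} - A) u"
            using M unfolding T_def by (intro sum_diff[symmetric]) auto
          then show ?case using C by simp
        qed
      qed
    qed simp
    then have "norm x + norm (T A x) \<le> C * norm x"
      unfolding T_def by (intro l1_daugavet_finite_rank A b)
    then show ?thesis by (simp add: algebra_simps)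
  qed
  have "finite A \<Longrightarrow> norm (T A u) \<le> (B - real k) * norm u" for k A u
  proof (induction k arbitrary: A u)
    case (Suc k)
    from improve[OF Suc.prems Suc.IH] show ?case by (simp add: algebra_simps)
  qed (simp add: B)
  \<comment> \<open>The empty sum already suffices: on the constant function 1, of norm 1, the bound
    forces \<open>real k\<close> to be at most \<open>B\<close> for every \<open>k\<close>.\<close>
  from this[of "{}"] have "0 \<le> (B - real k) * norm (abs_L1 (\<lambda>_. 1::'a))" for k
    by (simp add: T_def)
  moreover have "norm (abs_L1 (\<lambda>_. 1::'a)) = 1"
    by (simp add: norm_abs_L1 measure_restrict_space)
  moreover obtain k :: nat where "B < real k"
    using reals_Archimedean2 by blast
  ultimately show False by (metis diff_ge_0_iff_ge mult.right_neutral not_le)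
qed

theorem corollary5:
  shows "\<not> (\<exists>(a :: nat \<Rightarrow> real L1) (b :: nat \<Rightarrow> real L1 \<Rightarrow> real).
             besselian_schauder_frame l1_scale a b)
       \<and> \<not> (\<exists>(a :: nat \<Rightarrow> complex L1) (b :: nat \<Rightarrow> complex L1 \<Rightarrow> complex).
             besselian_schauder_frame l1_scale a b)"
  by (simp add: no_besselian_schauder_frame_L1)

end
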